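(* Let $r$ be a complex number and let $m,n\ge0$ be integers. Then, as polynomials in $x$, $$d_m^{(r)}(x)d_n^{(r)}(x)=\sum_{k=0}^{\min\{m,n\}}\binom{m+n-2k}{m-k}\binom{2r+m+n-k}{k}(-1)^kd_{m+n-2k}^{(r)}(x).$$
   Context: For a complex number (or polynomial) $a$ and an integer $k\ge0$, $\binom{a}{k}=a(a-1)\cdots(a-k+1)/k!$, and $\binom{a}{k}=0$ for $k<0$. For a parameter $r$ and an integer $n\ge 0$, define the polynomial $d_n^{(r)}(x)=\sum_{k=0}^n\binom{x+r+k}{k}\binom{x-r}{n-k}$. *)

theory Defs
  imports Complex_Main "HOL-Computational_Algebra.Polynomial"
begin

text \<open>
  The library's \<open>gchoose\<close> is restricted to upper entries in a field of characteristic 0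
  (type class \<open>field_char_0\<close>), which excludes polynomials.
\<close>

definition poly_choose :: "complex poly \<Rightarrow> nat \<Rightarrow> complex poly" where
  "poly_choose p k = smult (1 / fact k) (\<Prod>i=0..<k. p - of_nat i)"

lemma poly_poly_choose: "poly (poly_choose p k) x = poly p x gchoose k"
  by (simp add: poly_choose_def gbinomial_prod_rev poly_prod)

definition d_poly :: "complex \<Rightarrow> nat \<Rightarrow> complex poly" where
  "d_poly r n =
    (\<Sum>k=0..n. poly_choose [:r + of_nat k, 1:] k * poly_choose [:- r, 1:] (n - k))"

end

theory Submission
  imports Defs "HOL-Computational_Algebra.Formal_Power_Series"
begin

text \<open>
  For fixed \<open>x\<close>, the generating function of the values \<open>d\<^sub>n(x)\<close> is
  \<open>F(t) = (1 + t)\<^bsup>x-r\<^esup> (1 - t)\<^bsup>-x-r-1\<^esup>\<close>, so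
  \<open>(1 - t\<^sup>2) F' = ((2x + 1) + (2r + 1) t) F\<close>, which is the three-term recurrence
  \<open>(n + 2) d\<^bsub>n+2\<^esub> = (2x + 1) d\<^bsub>n+1\<^esub> + (n + 1 + 2r) d\<^sub>n\<close>. By symmetry one may assume
  \<open>m \<le> n\<close>; then the recurrence, used once in \<open>m\<close> and once to expand \<open>(2x + 1) d\<^sub>N\<close>, reduces
  the product formula, by induction on \<open>m\<close>, to an identity between its coefficients.
\<close>

section \<open>Binomial series and the three-term recurrence\<close>

lemma Suc_times_gbinomial_Suc:
  fixes a :: "'a :: field_char_0"
  shows "of_nat (Suc k) * (a gchoose Suc k) = (a - of_nat k) * (a gchoose k)"
  using gbinomial_mult_1[of a k] by (simp add: left_diff_distrib)

text \<open>\<open>G\<close> is the binomial series of \<open>(1 - t)^(-z-1)\<close>. At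
  \<open>t^n\<close> the equation reduces to absorption with upper entry
  \<open>z + n + 1\<close>.\<close>

lemma fps_deriv_one_minus_mult_gbinomial:
  fixes z :: "'a :: field_char_0"
  defines "G \<equiv> Abs_fps (\<lambda>k. (z + of_nat k) gchoose k)"
  shows "fps_deriv G * (1 - fps_X) = fps_const (z + 1) * G"
proof (rule fps_ext)
  fix n
  have "of_nat (Suc n) * ((z + of_nat (Suc n)) gchoose Suc n)
      = (z + of_nat (Suc n)) * ((z + of_nat n) gchoose n)"
    using gbinomial_absorption[of n "z + of_nat (Suc n)"] by simp
  then show "fps_nth (fps_deriv G * (1 - fps_X)) n = fps_nth (fps_const (z + 1) * G) n"
    by (cases n) (simp_all add: G_def algebra_simps)
qed

text \<open>\<open>H\<close> is the binomial series of \<open>(1 + t)^c\<close>.\<close>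

lemma fps_deriv_one_plus_mult_gbinomial:
  fixes c :: "'a :: field_char_0"
  defines "H \<equiv> Abs_fps (\<lambda>k. c gchoose k)"
  shows "fps_deriv H * (1 + fps_X) = fps_const c * H"
proof (rule fps_ext)
  fix n
  have "of_nat (Suc n) * (c gchoose Suc n) = (c - of_nat n) * (c gchoose n)"
    by (rule Suc_times_gbinomial_Suc)
  then show "fps_nth (fps_deriv H * (1 + fps_X)) n = fps_nth (fps_const c * H) n"
    by (cases n) (simp_all add: H_def algebra_simps)
qed

lemma poly_d_poly:
  "poly (d_poly r n) x = (\<Sum>k=0..n. ((x + r + of_nat k) gchoose k) * ((x - r) gchoose (n - k)))"
  by (simp add: d_poly_def poly_sum poly_poly_choose algebra_simps)

lemma d_poly_0: "d_poly r 0 = 1"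
  by (simp add: d_poly_def poly_choose_def)

lemma d_poly_1: "d_poly r 1 = [:1, 2:]"
  by (simp add: d_poly_def poly_choose_def)

lemma d_poly_rec:
  "of_nat (n + 2) * poly (d_poly r (n + 2)) x
    = (2 * x + 1) * poly (d_poly r (n + 1)) x + (of_nat n + 1 + 2 * r) * poly (d_poly r n) x"
proof -
  define G where "G = Abs_fps (\<lambda>k. (x + r + of_nat k) gchoose k)"
  define H where "H = Abs_fps (\<lambda>k. (x - r) gchoose k)"
  define F where "F = G * H"
  have nth: "fps_nth F k = poly (d_poly r k) x" for k
    by (simp add: F_def G_def H_def fps_mult_nth poly_d_poly)
  have G: "fps_deriv G * (1 - fps_X) = fps_const (x + r + 1) * G"
    unfolding G_def by (rule fps_deriv_one_minus_mult_gbinomial)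
  have H: "fps_deriv H * (1 + fps_X) = fps_const (x - r) * H"
    unfolding H_def by (rule fps_deriv_one_plus_mult_gbinomial)
  \<comment> \<open>The left side is \<open>(1 - t^2) F'\<close>. After the product rule,
    \<open>1 - t^2\<close> is split so that each derivative meets the factor of its own differential
    equation.\<close>
  have "fps_deriv F - fps_X * (fps_X * fps_deriv F)
      = (fps_deriv G * (1 - fps_X)) * H * (1 + fps_X) + (fps_deriv H * (1 + fps_X)) * G * (1 - fps_X)"
    by (simp add: F_def algebra_simps)
  also have "\<dots> = fps_const (x + r + 1) * F + fps_const (x - r) * F
      + (fps_X * (fps_const (x + r + 1) * F) - fps_X * (fps_const (x - r) * F))"
    unfolding G H by (simp add: F_def algebra_simps)
  \<comment> \<open>At \<open>t^(n+1)\<close>, \<open>F'\<close> contributes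
    \<open>(n + 2) d_(n+2)\<close> and \<open>t^2 F'\<close> contributes
    \<open>n d_n\<close>.\<close>
  finally have "fps_nth (fps_deriv F - fps_X * (fps_X * fps_deriv F)) (Suc n) = fps_nth \<dots> (Suc n)"
    by (rule arg_cong)
  then show ?thesis
    by (cases n; simp add: nth del: fps_const_add fps_const_sub) (simp_all add: algebra_simps)
qed

section \<open>Linearization coefficients and their recurrences\<close>

definition lin_coeff :: "complex \<Rightarrow> nat \<Rightarrow> nat \<Rightarrow> nat \<Rightarrow> complex" where
  "lin_coeff r m n k = of_nat ((m + n - 2 * k) choose (m - k))
     * ((2 * r + of_nat m + of_nat n - of_nat k) gchoose k) * (-1) ^ k"

text \<open>With \<open>m = a + j\<close>, \<open>n = b + j + 1\<close> and
  \<open>s = 2 * r\<close>, this is the recurrence for the coefficients at \<open>k = j + 1\<close>,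
  freed of its sign. All terms reduce to two binomials \<open>C\<close>, \<open>C'\<close> and two
  generalized ones \<open>p\<close>, \<open>g\<close>.\<close>

lemma gbinomial_step_identity:
  fixes y s :: complex and a b j :: nat
  defines "y \<equiv> s + of_nat a + of_nat b + of_nat j + 2"
  shows "of_nat (a + j + 2) * of_nat ((a + b + 1) choose (a + 1)) * (y gchoose Suc j)
    = of_nat (a + b + 1) * of_nat ((a + b) choose a) * ((y - 1) gchoose Suc j)
      + (y - of_nat j) * of_nat ((a + b + 2) choose (a + 1)) * (y gchoose j)
      - (of_nat (a + j) + 1 + s) * of_nat ((a + b + 1) choose a) * ((y - 1) gchoose j)"
proof -
  define C where "C = (of_nat ((a + b + 1) choose (a + 1)) :: complex)"
  define C' where "C' = (of_nat ((a + b + 1) choose a) :: complex)"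
  define p where "p = ((y - 1) gchoose j)"
  define g where "g = (y gchoose Suc j)"
  have 1: "of_nat (a + b + 1) * of_nat ((a + b) choose a) = of_nat (a + 1) * C"
    using Suc_times_binomial_eq[of "a + b" a] unfolding C_def of_nat_mult[symmetric]
    by (simp add: mult.commute)
  have 2: "of_nat ((a + b + 2) choose (a + 1)) = C + C'"
    by (simp add: C_def C'_def)
  have "(a + 1) * ((a + b + 1) choose (a + 1)) = (b + 1) * ((a + b + 1) choose a)"
    using Suc_times_binomial_add[of a b] binomial_symmetric[of a "a+b+1"]
      binomial_symmetric[of "a+1" "a+b+1"] by (simp add: add_ac)
  then have 3: "of_nat (a + 1) * C = of_nat (b + 1) * C'"
    unfolding C_def C'_def of_nat_mult[symmetric] by presburger
  have 4: "((y - 1) gchoose Suc j) = g - p"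
    using gbinomial_Suc_Suc[of "y - 1" j] by (simp add: g_def p_def)
  have 5: "(y - of_nat j) * (y gchoose j) = of_nat (Suc j) * g"
    unfolding g_def by (rule Suc_times_gbinomial_Suc[symmetric])
  have 6: "of_nat (Suc j) * g = y * p"
    unfolding g_def p_def by (rule gbinomial_absorption)
  have "(of_nat (a + b + 1) * of_nat ((a + b) choose a)) * ((y - 1) gchoose Suc j)
      + of_nat ((a + b + 2) choose (a + 1)) * ((y - of_nat j) * (y gchoose j))
      - (of_nat (a + j) + 1 + s) * C' * p
      = of_nat (a + 1) * C * (g - p) + (C + C') * (of_nat (Suc j) * g)
        - (y - of_nat (b + 1)) * C' * p"
    unfolding 1 2 4 5 by (simp add: y_def)
  \<comment> \<open>Grouped so that the two differences vanish by facts \<open>3\<close> and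
    \<open>6\<close>.\<close>
  also have "\<dots> = of_nat (a + 1) * C * g + C * (of_nat (Suc j) * g)
      + (of_nat (b + 1) * C' - of_nat (a + 1) * C) * p + C' * (of_nat (Suc j) * g - y * p)"
    by (simp only: algebra_simps)
  also have "\<dots> = of_nat (a + j + 2) * C * g"
    unfolding 3[symmetric] 6[symmetric] diff_self by (simp add: algebra_simps)
  finally show ?thesis
    by (simp only: C_def C'_def g_def p_def mult_ac)
qed

text \<open>Compares coefficients of \<open>d_(m+n+2)\<close> in
  \<open>(m+2) d_(m+2) d_n = (2x+1) d_(m+1) d_n + (m+1+2r) d_m d_n\<close>. Only the index-raising
  part of \<open>2x+1\<close> reaches this top index.\<close>

lemma lin_coeff_rec_0:
  "of_nat (m + 2) * lin_coeff r (m + 2) n 0 = of_nat (m + n + 2) * lin_coeff r (m + 1) n 0"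
  using Suc_times_binomial_eq[of "m + 1 + n" "m + 1"]
  by (simp add: lin_coeff_def flip: of_nat_mult of_nat_Suc of_nat_add)

text \<open>The same comparison at \<open>d_(m+n-2j)\<close>: the terms on the right come from
  raising at \<open>k = j + 1\<close>, lowering at \<open>k = j\<close>, and the product
  \<open>d_m d_n\<close>.\<close>

lemma lin_coeff_rec_Suc:
  assumes "j \<le> m" "m + 2 \<le> n"
  shows "of_nat (m + 2) * lin_coeff r (m + 2) n (Suc j)
    = of_nat (m + n - 2 * j) * lin_coeff r (m + 1) n (Suc j)
      - (of_nat (m + 1 + n - 2 * j) + 2 * r) * lin_coeff r (m + 1) n j
      + (of_nat m + 1 + 2 * r) * lin_coeff r m n j"
proof -
  \<comment> \<open>Writing \<open>m\<close> and \<open>n\<close> through \<open>a\<close>,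
    \<open>b\<close> and \<open>j\<close> removes all truncated subtractions.\<close>
  obtain a where a: "m = a + j" using assms by (metis le_add_diff_inverse2)
  obtain b where b: "n = b + j + 1"
    using that[of "n - j - 1"] assms by simp
  define y where "y = 2 * r + of_nat a + of_nat b + of_nat j + 2"
  have "lin_coeff r (m + 2) n (Suc j)
      = - (of_nat ((a + b + 1) choose (a + 1)) * (y gchoose Suc j) * (-1) ^ j)"
    by (simp add: lin_coeff_def a b y_def add_ac)
  moreover have "lin_coeff r (m + 1) n (Suc j)
      = - (of_nat ((a + b) choose a) * ((y - 1) gchoose Suc j) * (-1) ^ j)"
    by (simp add: lin_coeff_def a b y_def add_ac)
  moreover have "lin_coeff r (m + 1) n j
      = of_nat ((a + b + 2) choose (a + 1)) * (y gchoose j) * (-1) ^ j"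
    by (simp add: lin_coeff_def a b y_def add_ac)
  moreover have "lin_coeff r m n j
      = of_nat ((a + b + 1) choose a) * ((y - 1) gchoose j) * (-1) ^ j"
    by (simp add: lin_coeff_def a b y_def add_ac)
  moreover have "m + n - 2 * j = a + b + 1" "of_nat (m + 1 + n - 2 * j) + 2 * r = y - of_nat j"
    by (simp_all add: a b y_def)
  moreover note arg_cong[OF gbinomial_step_identity[of a j b "2 * r", folded y_def],
      of "\<lambda>t. - (t * (-1) ^ j)"]
  ultimately show ?thesis
    by (simp only: a of_nat_add) (simp add: ring_distribs mult_ac del: binomial_Suc_Suc)
qed

text \<open>The same comparison at the lowest index \<open>n - m - 2\<close>, reached only by
  lowering. Both ordinary binomials are 1, and both generalized ones have upper entry
  \<open>2 * r + n\<close>.\<close>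

lemma lin_coeff_rec_last:
  assumes "m + 2 \<le> n"
  shows "of_nat (m + 2) * lin_coeff r (m + 2) n (m + 2)
    = - (of_nat (n - m - 1) + 2 * r) * lin_coeff r (m + 1) n (m + 1)"
proof -
  obtain b where b: "n = b + m + 2" using assms by (metis le_add_diff_inverse2 add.assoc)
  define y where "y = 2 * r + of_nat b + of_nat m + 2"
  have "of_nat (Suc (m + 1)) * (y gchoose Suc (m + 1)) = (y - of_nat (m + 1)) * (y gchoose (m + 1))"
    by (rule Suc_times_gbinomial_Suc)
  then show ?thesis
    by (simp add: lin_coeff_def b y_def algebra_simps)
qed

section \<open>The product formula\<close>

text \<open>The recurrence has order two, hence a two-step induction; \<open>m \<le> n\<close> keeps
  \<open>m + n - 2 * k\<close> from truncating.\<close>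

lemma d_poly_mult_le:
  assumes "m \<le> n"
  shows "poly (d_poly r m) x * poly (d_poly r n) x
    = (\<Sum>k\<le>m. lin_coeff r m n k * poly (d_poly r (m + n - 2 * k)) x)"
  using assms
proof (induction m rule: induct_nat_012)
  case 0
  show ?case by (simp add: d_poly_0 lin_coeff_def)
next
  case 1
  \<comment> \<open>As \<open>d_1 = 2x + 1\<close>, this case is the recurrence itself.\<close>
  then obtain n' where "n = Suc n'" by (cases n) auto
  then show ?case
    using d_poly_rec[of n' r x] d_poly_1[of r]
    by (simp add: lin_coeff_def algebra_simps)
next
  case (ge2 m)
  define d where "d k = poly (d_poly r k) x" for k
  \<comment> \<open>Multiplication by \<open>2x + 1\<close> moves the index up or down by one;
    \<open>N > 0\<close> makes \<open>N - 1\<close> a genuine predecessor.\<close>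
  have rec: "(2 * x + 1) * d N = of_nat (N + 1) * d (N + 1) - (of_nat N + 2 * r) * d (N - 1)"
    if "N > 0" for N
    using d_poly_rec[of "N - 1" r x] that by (cases N) (simp_all add: d_def algebra_simps)
  have mn: "m + 2 \<le> n" using ge2.prems by simp
  have IH1: "d (m + 1) * d n = (\<Sum>k\<le>m+1. lin_coeff r (m + 1) n k * d (m + 1 + n - 2 * k))"
    using ge2.IH(2) mn by (simp add: d_def)
  have IH0: "d m * d n = (\<Sum>k\<le>m. lin_coeff r m n k * d (m + n - 2 * k))"
    using ge2.IH(1) mn by (simp add: d_def)
  \<comment> \<open>Raised terms are shifted by one in \<open>k\<close> to align with the lowered
    ones, leaving the top term alone; \<open>down\<close> likewise isolates the bottom term.\<close>
  have up: "(\<Sum>k\<le>m+1. of_nat (m + 2 + n - 2 * k) * lin_coeff r (m + 1) n k * d (m + 2 + n - 2 * k))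
      = of_nat (m + n + 2) * lin_coeff r (m + 1) n 0 * d (m + n + 2)
        + (\<Sum>k\<le>m. of_nat (m + n - 2 * k) * lin_coeff r (m + 1) n (Suc k) * d (m + n - 2 * k))"
    by (simp add: sum.atMost_Suc_shift add_ac del: sum.atMost_Suc)
  have down: "(\<Sum>k\<le>m+1. (of_nat (m + 1 + n - 2 * k) + 2 * r) * lin_coeff r (m + 1) n k * d (m + n - 2 * k))
      = (\<Sum>k\<le>m. (of_nat (m + 1 + n - 2 * k) + 2 * r) * lin_coeff r (m + 1) n k * d (m + n - 2 * k))
        + (of_nat (n - m - 1) + 2 * r) * lin_coeff r (m + 1) n (m + 1) * d (n - m - 2)"
    using mn by (simp add: algebra_simps)
  have "(2 * x + 1) * (d (m + 1) * d n)
      = (\<Sum>k\<le>m+1. lin_coeff r (m + 1) n k * ((2 * x + 1) * d (m + 1 + n - 2 * k)))"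
    unfolding IH1 sum_distrib_left by (simp only: mult_ac)
  also have "\<dots> = (\<Sum>k\<le>m+1. of_nat (m + 2 + n - 2 * k) * lin_coeff r (m + 1) n k * d (m + 2 + n - 2 * k)
        - (of_nat (m + 1 + n - 2 * k) + 2 * r) * lin_coeff r (m + 1) n k * d (m + n - 2 * k))"
  proof (rule sum.cong[OF refl])
    fix k assume "k \<in> {..m+1}"
    then have k: "m + 1 + n - 2 * k > 0" "m + 1 + n - 2 * k + 1 = m + 2 + n - 2 * k"
      "m + 1 + n - 2 * k - 1 = m + n - 2 * k"
      using mn by auto
    show "lin_coeff r (m + 1) n k * ((2 * x + 1) * d (m + 1 + n - 2 * k))
      = of_nat (m + 2 + n - 2 * k) * lin_coeff r (m + 1) n k * d (m + 2 + n - 2 * k)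
        - (of_nat (m + 1 + n - 2 * k) + 2 * r) * lin_coeff r (m + 1) n k * d (m + n - 2 * k)"
      unfolding rec[OF k(1)] k(2,3) by (simp only: right_diff_distrib mult_ac)
  qed
  finally have X: "(2 * x + 1) * (d (m + 1) * d n) = \<dots>" .
  have middle: "(\<Sum>k\<le>m. of_nat (m + 2) * lin_coeff r (m + 2) n (Suc k) * d (m + n - 2 * k))
      = (\<Sum>k\<le>m. of_nat (m + n - 2 * k) * lin_coeff r (m + 1) n (Suc k) * d (m + n - 2 * k))
        - (\<Sum>k\<le>m. (of_nat (m + 1 + n - 2 * k) + 2 * r) * lin_coeff r (m + 1) n k * d (m + n - 2 * k))
        + (of_nat m + 1 + 2 * r) * (\<Sum>k\<le>m. lin_coeff r m n k * d (m + n - 2 * k))"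
    unfolding sum_distrib_left sum_subtractf[symmetric] sum.distrib[symmetric]
  proof (rule sum.cong[OF refl])
    fix k assume "k \<in> {..m}"
    then have "k \<le> m" by simp
    show "of_nat (m + 2) * lin_coeff r (m + 2) n (Suc k) * d (m + n - 2 * k)
      = of_nat (m + n - 2 * k) * lin_coeff r (m + 1) n (Suc k) * d (m + n - 2 * k)
        - (of_nat (m + 1 + n - 2 * k) + 2 * r) * lin_coeff r (m + 1) n k * d (m + n - 2 * k)
        + (of_nat m + 1 + 2 * r) * (lin_coeff r m n k * d (m + n - 2 * k))"
      unfolding lin_coeff_rec_Suc[OF \<open>k \<le> m\<close> mn]
      by (simp only: distrib_right left_diff_distrib mult.assoc)
  qed
  have "of_nat (m + 2) * (d (m + 2) * d n)
      = (2 * x + 1) * (d (m + 1) * d n) + (of_nat m + 1 + 2 * r) * (d m * d n)"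
    using arg_cong[OF d_poly_rec[of m r x], of "\<lambda>t. t * d n"]
    unfolding d_def by (simp only: distrib_right mult.assoc)
  also have "\<dots> = of_nat (m + 2) * lin_coeff r (m + 2) n 0 * d (m + n + 2)
      + (\<Sum>k\<le>m. of_nat (m + 2) * lin_coeff r (m + 2) n (Suc k) * d (m + n - 2 * k))
      + of_nat (m + 2) * lin_coeff r (m + 2) n (m + 2) * d (n - m - 2)"
    unfolding X IH0 sum_subtractf up down middle lin_coeff_rec_0 lin_coeff_rec_last[OF mn]
    by (simp only: mult_minus_left) simp
  also have "\<dots> = of_nat (m + 2) * (\<Sum>k\<le>m+2. lin_coeff r (m + 2) n k * d (m + 2 + n - 2 * k))"
  proof -
    have "(\<Sum>k\<le>m+2. lin_coeff r (m + 2) n k * d (m + 2 + n - 2 * k))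
       = (\<Sum>k\<le>Suc m. lin_coeff r (m + 2) n k * d (m + 2 + n - 2 * k))
         + lin_coeff r (m + 2) n (m + 2) * d (n - m - 2)"
      using mn by (simp add: add_ac)
    also have "(\<Sum>k\<le>Suc m. lin_coeff r (m + 2) n k * d (m + 2 + n - 2 * k))
       = lin_coeff r (m + 2) n 0 * d (m + n + 2)
         + (\<Sum>k\<le>m. lin_coeff r (m + 2) n (Suc k) * d (m + n - 2 * k))"
      unfolding sum.atMost_Suc_shift by (simp add: add_ac)
    finally show ?thesis
      by (simp only: sum_distrib_left distrib_left mult.assoc)
  qed
  finally have "of_nat (m + 2) * (d (m + 2) * d n)
      = of_nat (m + 2) * (\<Sum>k\<le>m+2. lin_coeff r (m + 2) n k * d (m + 2 + n - 2 * k))" .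
  then have "d (m + 2) * d n = (\<Sum>k\<le>m+2. lin_coeff r (m + 2) n k * d (m + 2 + n - 2 * k))"
    by (simp only: mult_cancel_left of_nat_eq_0_iff) simp
  then show ?case
    by (simp add: d_def)
qed

text \<open>Since \<open>(m - k) + (n - k) = m + n - 2 * k\<close>, this is binomial
  symmetry.\<close>

lemma lin_coeff_commute:
  assumes "k \<le> min m n"
  shows "lin_coeff r m n k = lin_coeff r n m k"
proof -
  have "m - k \<le> m + n - 2 * k" "m + n - 2 * k - (m - k) = n - k" "n + m - 2 * k = m + n - 2 * k"
    using assms by auto
  then show ?thesis
    using binomial_symmetric[of "m - k" "m + n - 2 * k"] by (simp add: lin_coeff_def add_ac)
qed

lemma d_poly_mult:
  "poly (d_poly r m) x * poly (d_poly r n) x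
    = (\<Sum>k=0..min m n. lin_coeff r m n k * poly (d_poly r (m + n - 2 * k)) x)"
proof (cases "m \<le> n")
  case True
  then show ?thesis
    by (simp add: d_poly_mult_le atLeast0AtMost)
next
  case False
  then have "poly (d_poly r m) x * poly (d_poly r n) x
      = (\<Sum>k\<le>n. lin_coeff r n m k * poly (d_poly r (n + m - 2 * k)) x)"
    using d_poly_mult_le[of n m r x] by (simp add: mult.commute)
  also have "\<dots> = (\<Sum>k\<le>n. lin_coeff r m n k * poly (d_poly r (m + n - 2 * k)) x)"
    using False by (intro sum.cong) (auto simp: lin_coeff_commute[of _ n m] add.commute)
  finally show ?thesis
    using False by (simp add: atLeast0AtMost)
qed

theorem theorem2p7:
  fixes r :: complex and m n :: nat
  shows "d_poly r m * d_poly r n =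
    (\<Sum>k=0..min m n.
      smult (of_nat ((m + n - 2 * k) choose (m - k))
             * ((2 * r + of_nat m + of_nat n - of_nat k) gchoose k)
             * (-1) ^ k)
        (d_poly r (m + n - 2 * k)))"
  \<comment> \<open>Polynomials over the complex numbers are equal once all their values
    agree.\<close>
  unfolding poly_eq_poly_eq_iff[symmetric] lin_coeff_def[symmetric]
  by (rule ext) (simp add: d_poly_mult poly_sum)

end
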